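(* Let $X$ be a real or complex Banach space, let $A:\mathbb{N}\to\mathcal{B}(X)$ be a sequence of bounded linear operators on $X$, and consider the linear discrete-time system $x_{n+1}=A(n)x_n$ with associated operators $\mathcal{A}_m^n$ ($m\ge n$). The system is uniformly power instable if and only if there exist constants $D\ge 1$ and $d>1$ such that $$\sum_{k=n}^{m} d^{\,m-k}\,\|\mathcal{A}_k^n x\|\le D\,\|\mathcal{A}_m^n x\|\qquad\text{for all } (m,n)\in\Delta \text{ and all } x\in X.$$
   Context: $\mathbb{N}$ denotes the set of all positive integers. $\mathcal{B}(X)$ is the Banach algebra of all bounded linear operators from $X$ into itself; the norms on $X$ and on $\mathcal{B}(X)$ are both denoted $\|\cdot\|$. $\Delta$ is the set of all pairs $(m,n)$ of positive integers with $m\ge n$. $T$ is the set of all triplets $(m,n,p)$ of positive integers with $(m,n)\in\Delta$ and $(n,p)\in\Delta$ (i.e. $m\ge n\ge p$). For $(m,n)\in\Delta$ the operators associated with the system are defined by $\mathcal{A}_m^n=A(m)\cdot A(m-1)\cdots A(n+1)$ if $m>n$, and $\mathcal{A}_m^n=I$ (the identity on $X$) if $m=n$. The system is called uniformly power instable if there are constants $N\ge 1$ and $r\in(0,1)$ such that $\|\mathcal{A}_n^p x\|\le N r^{m-n}\|\mathcal{A}_m^p x\|$ for all $(m,n,p)\in T$ and all $x\in X$. *)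

theory Defs
  imports "HOL-Analysis.Bounded_Linear_Function"
begin

text \<open>
  A Banach space over the scalar field \<open>'k\<close>. By the Gelfand-Mazur theorem the instances of
  \<^class>\<open>real_normed_field\<close> are, up to isometric isomorphism, exactly the reals and the complex
  numbers, so this is precisely a real or complex Banach space. Completeness comes from
  \<^class>\<open>banach\<close>; the axiom \<open>scale_of_real\<close> says that the real structure of that class is the
  restriction of \<open>scale\<close>.
\<close>

locale banach_space_over = vector_space scale
  for scale :: "'k::real_normed_field \<Rightarrow> 'a::banach \<Rightarrow> 'a" +
  assumes scale_of_real: "scale (of_real r) x = r *\<^sub>R x"
    and norm_scale: "norm (scale c x) = norm c * norm x"

lemma banach_space_over_scaleR:
  "banach_space_over (scaleR :: real \<Rightarrow> 'a::banach \<Rightarrow> 'a)"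
  by unfold_locales (simp_all add: scaleR_right_distrib scaleR_left_distrib)

lemma banach_space_over_mult:
  "banach_space_over ((*) :: 'k::{real_normed_field,banach} \<Rightarrow> 'k \<Rightarrow> 'k)"
  by unfold_locales (simp_all add: algebra_simps scaleR_conv_of_real norm_mult)

definition Delta :: "(nat \<times> nat) set" where
  "Delta = {(m, n). 1 \<le> n \<and> n \<le> m}"

definition Triples :: "(nat \<times> nat \<times> nat) set" where
  "Triples = {(m, n, p). (m, n) \<in> Delta \<and> (n, p) \<in> Delta}"

text \<open>
  \<open>evol A m n\<close> is \<open>A(m) A(m-1) \<dots> A(n+1)\<close> for \<open>m > n\<close>. The value for \<open>m < n\<close> is a dummy.
\<close>

fun evol :: "(nat \<Rightarrow> 'a::real_normed_vector \<Rightarrow>\<^sub>L 'a) \<Rightarrow> nat \<Rightarrow> nat \<Rightarrow> 'a \<Rightarrow>\<^sub>L 'a" where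
  "evol A m n = (if m \<le> n then id_blinfun else A m o\<^sub>L evol A (m - 1) n)"

declare evol.simps [simp del]

definition uniformly_power_instable ::
    "(nat \<Rightarrow> 'a::real_normed_vector \<Rightarrow>\<^sub>L 'a) \<Rightarrow> bool" where
  "uniformly_power_instable A \<longleftrightarrow>
     (\<exists>N r :: real. N \<ge> 1 \<and> 0 < r \<and> r < 1 \<and>
        (\<forall>(m, n, p) \<in> Triples. \<forall>x.
           norm (evol A n p x) \<le> N * r ^ (m - n) * norm (evol A m p x)))"

end

theory Submission
  imports Defs
begin

text \<open>
  Both conditions say that \<open>\<parallel>\<A>\<^sub>k\<^sup>n x\<parallel>\<close> is dominated by \<open>\<parallel>\<A>\<^sub>m\<^sup>n x\<parallel>\<close> times a quantity decaying
  geometrically in \<open>m - k\<close>; one bounds each term, the other a weighted sum of the terms.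

  From terms to sums, some of the decay has to be given up: with rate \<open>r\<close>, any weight \<open>d\<close>
  strictly between \<open>1\<close> and \<open>1/r\<close> makes the weighted terms decay like \<open>(d r)\<^bsup>m - k\<^esup>\<close>, and a
  geometric series with ratio \<open>d r < 1\<close> has partial sums bounded uniformly in \<open>m\<close> and \<open>n\<close>
  (\<open>sum_descending_powers_le\<close>). From sums to terms nothing is lost: all terms are nonnegative,
  so each is at most the sum, and \<open>r = 1/d\<close> is a rate of instability.
\<close>

lemma sum_descending_powers_le:
  fixes q :: real
  assumes "0 \<le> q" "q < 1"
  shows "(\<Sum>k = n..m. q ^ (m - k)) \<le> 1 / (1 - q)"
proof (cases "n \<le> m")
  case True
  have "(\<Sum>k = n..m. q ^ (m - k)) = (\<Sum>j<Suc (m - n). q ^ j)"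
    using True
    by (intro sum.reindex_bij_witness[where i = "\<lambda>j. m - j" and j = "\<lambda>k. m - k"]) auto
  also have "\<dots> \<le> (\<Sum>j. q ^ j)"
    using assms by (intro sum_le_suminf summable_geometric) auto
  also have "\<dots> = 1 / (1 - q)"
    using assms by (intro suminf_geometric) auto
  finally show ?thesis .
next
  case False
  then show ?thesis using assms by simp
qed

lemma instable_imp_weighted_sum_bound:
  assumes "uniformly_power_instable A"
  shows "\<exists>D d :: real. D \<ge> 1 \<and> d > 1 \<and>
    (\<forall>(m, n) \<in> Delta. \<forall>x.
       (\<Sum>k = n..m. d ^ (m - k) * norm (evol A k n x)) \<le> D * norm (evol A m n x))"
proof -
  obtain N r :: real where N: "N \<ge> 1" and r: "0 < r" "r < 1"
    and decay: "\<forall>(m, n, p) \<in> Triples. \<forall>x.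
      norm (evol A n p x) \<le> N * r ^ (m - n) * norm (evol A m p x)"
    using assms unfolding uniformly_power_instable_def by blast
  \<comment> \<open>The midpoint of \<open>1\<close> and \<open>1/r\<close>, so that \<open>d r\<close> is the midpoint of \<open>r\<close> and \<open>1\<close>.\<close>
  define d where "d = (1 + 1 / r) / 2"
  define q where "q = d * r"
  have d: "d > 1" using r by (simp add: d_def field_simps)
  have "q = (r + 1) / 2" using r by (simp add: q_def d_def field_simps)
  then have q: "0 < q" "q < 1" using r by simp_all
  have "(\<Sum>k = n..m. d ^ (m - k) * norm (evol A k n x)) \<le> N / (1 - q) * norm (evol A m n x)"
    if mn: "(m, n) \<in> Delta" for m n x
  proof -
    have "d ^ (m - k) * norm (evol A k n x) \<le> N * norm (evol A m n x) * q ^ (m - k)"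
      if "k \<in> {n..m}" for k
    proof -
      have "(m, k, n) \<in> Triples"
        using mn that by (auto simp: Triples_def Delta_def)
      then have "norm (evol A k n x) \<le> N * r ^ (m - k) * norm (evol A m n x)"
        using decay by blast
      then have "d ^ (m - k) * norm (evol A k n x)
          \<le> d ^ (m - k) * (N * r ^ (m - k) * norm (evol A m n x))"
        using d by (intro mult_left_mono) auto
      then show ?thesis by (simp add: q_def power_mult_distrib mult_ac)
    qed
    then have "(\<Sum>k = n..m. d ^ (m - k) * norm (evol A k n x))
        \<le> N * norm (evol A m n x) * (\<Sum>k = n..m. q ^ (m - k))"
      unfolding sum_distrib_left by (rule sum_mono)
    also have "\<dots> \<le> N * norm (evol A m n x) * (1 / (1 - q))"
      using N q by (intro mult_left_mono sum_descending_powers_le) auto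
    finally show ?thesis by simp
  qed
  moreover have "N / (1 - q) \<ge> 1" using N q by (simp add: field_simps)
  ultimately show ?thesis using d by blast
qed

lemma weighted_sum_bound_imp_instable:
  fixes D d :: real
  assumes D: "D \<ge> 1" and d: "d > 1"
    and bound: "\<forall>(m, n) \<in> Delta. \<forall>x.
      (\<Sum>k = n..m. d ^ (m - k) * norm (evol A k n x)) \<le> D * norm (evol A m n x)"
  shows "uniformly_power_instable A"
proof -
  have "norm (evol A n p x) \<le> D * (1 / d) ^ (m - n) * norm (evol A m p x)"
    if "(m, n, p) \<in> Triples" for m n p x
  proof -
    have mp: "(m, p) \<in> Delta" and n: "n \<in> {p..m}"
      using that by (auto simp: Triples_def Delta_def)
    have "d ^ (m - n) * norm (evol A n p x)
        \<le> (\<Sum>k = p..m. d ^ (m - k) * norm (evol A k p x))"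
      using n d by (intro member_le_sum[where f = "\<lambda>k. d ^ (m - k) * norm (evol A k p x)"]) auto
    also have "\<dots> \<le> D * norm (evol A m p x)"
      using bound mp by blast
    finally show ?thesis using d by (simp add: field_simps)
  qed
  moreover have "0 < 1 / d" "1 / d < 1" using d by simp_all
  ultimately show ?thesis
    unfolding uniformly_power_instable_def using D by blast
qed

theorem corollary2p3:
  fixes scale :: "'k::real_normed_field \<Rightarrow> 'a::banach \<Rightarrow> 'a"
    and A :: "nat \<Rightarrow> 'a \<Rightarrow>\<^sub>L 'a"
  assumes "banach_space_over scale"
    and "\<And>n. n \<ge> 1 \<Longrightarrow> Vector_Spaces.linear scale scale (blinfun_apply (A n))"
  shows "uniformly_power_instable A \<longleftrightarrow>
    (\<exists>D d :: real. D \<ge> 1 \<and> d > 1 \<and>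
       (\<forall>(m, n) \<in> Delta. \<forall>x.
          (\<Sum>k = n..m. d ^ (m - k) * norm (evol A k n x)) \<le> D * norm (evol A m n x)))"
  using instable_imp_weighted_sum_bound weighted_sum_bound_imp_instable by blast

end
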